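(* Let $S$ be a finite set of formulas signed with $\mathbf{T}$ or $\mathbf{F}$, and let $\mathrm{G}$ be the procedure described in the context. Then: (i) if $\mathrm{G}(S)$ returns NULL, there exists a linearly ordered Kripke model $\underline{K}=\langle P,\leq,\rho,\Vdash\rangle$ such that $\rho$ realizes $S$; (ii) if $\mathrm{G}(S)$ returns a proof, then for every linearly ordered Kripke model $\underline{K}=\langle P,\leq,\rho,\Vdash\rangle$ and every $\alpha\in P$, $\alpha$ does not realize $S$.
   Context: Formulas are built from propositional variables and $\top,\bot$ using $\land,\lor,\to$. A model is $\langle P,\leq,\rho,\Vdash\rangle$ with $\langle P,\leq\rangle$ a linear order with minimum $\rho$, forcing on atoms upward persistent, $\top$ always and $\bot$ never forced, extended as usual ($\alpha\Vdash A\to B$ iff for all $\beta\ge\alpha$, $\beta\Vdash A$ implies $\beta\Vdash B$). $\alpha$ realizes $\mathbf{T}A$ iff $\alpha\Vdash A$, realizes $\mathbf{F}A$ iff $\alpha\not\Vdash A$, and realizes a set iff it realizes all its members. During deduction an auxiliary label $\overline{\mathbf{T}}$ is used (for implications $\mathbf{T}(A\to B)$ temporarily not available to the rules; $\alpha$ realizes $\overline{\mathbf{T}}A$ iff $\alpha\Vdash A$). A set is inconsistent iff it contains $\mathbf{T}\bot$ or both $\mathbf{T}A$ and $\mathbf{F}A$. For a set $S$ and formula $A$, $S\models A$ holds iff $\mathbf{T}A\in S$ or $\overline{\mathbf{T}}A\in S$ or: $A=B\land C$ with $S\models B$ and $S\models C$; or $A=B\lor C$ with $S\models B$ or $S\models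 C$; or $A=B\to C$, $\mathbf{F}(B\to C)\notin S$, and $S\models B$ implies $S\models C$. Rules of calculus $\mathbf{D_3}$ (premise / conclusions): ($\mathbf{T}\land$) $S,\mathbf{T}(A\land B)$ / $S,\mathbf{T}A,\mathbf{T}B$; ($\mathbf{F}\land$) $S,\mathbf{F}(A\land B)$ / $S,\mathbf{F}A,\mathbf{F}B\mid S,\mathbf{F}A,\mathbf{T}B\mid S,\mathbf{T}A,\mathbf{F}B$; ($\mathbf{T}\lor$) $S,\mathbf{T}(A\lor B)$ / $S,\mathbf{T}A\mid S,\mathbf{T}B$; ($\mathbf{F}\lor$) $S,\mathbf{F}(A\lor B)$ / $S,\mathbf{F}A,\mathbf{F}B$; ($\mathbf{T}\to_1$) $S,\mathbf{T}(A\to B)$ / $S,\mathbf{T}B\mid S,\mathbf{F}A,\overline{\mathbf{T}}(A\to B)$; ($\overline{\mathbf{T}}$) $S,\overline{\mathbf{T}}(A\to B)$ / $S,\mathbf{T}B$, provided $S\models A$; ($\mathbf{F}\to$) $S,\mathbf{F}(A_1\to B_1),\dots,\mathbf{F}(A_u\to B_u)$ / $S_c,V_1\mid\dots\mid S_c,V_u$ where $V_j=\{\mathbf{F}(A_i\to B_i):i\ne j\}\cup\{\mathbf{T}A_j,\mathbf{F}B_j\}$ and $S_c=\{\mathbf{T}A\in S\}\cup\{\overline{\mathbf{T}}A\in S\}$. In each rule the displayed premise formulas are not in $S$. A closed proof table (proof) is a tree of rule applications all of whose leaves are inconsistent. Procedure $\mathrm{G}(S)$ (returns a proof of $S$ or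 NULL), trying steps in order: (1) if $S$ is inconsistent return the proof $S$; (2) if $\mathbf{T}\land$ or $\mathbf{F}\lor$ applies to some $H\in S$, recurse on the conclusion, returning NULL if it does, else the table with root $S$ over the returned proof; (3) if $\mathbf{T}\lor$ or $\mathbf{T}\to_1$ applies to some $H\in S$, recurse on both conclusions, NULL if either is NULL, else the combined table; (4) if $\mathbf{F}\land$ applies to some $\mathbf{F}(A\land B)\in S$, recurse on the three conclusions similarly; (5) if $\overline{\mathbf{T}}(A\to B)\in S$ and $S\models A$, recurse on $(S\setminus\{\overline{\mathbf{T}}(A\to B)\})\cup\{\mathbf{T}B\}$, NULL if NULL, else combined table; (6) if $S$ contains some $\mathbf{F}$-implication, apply $\mathbf{F}\to$ with all $\mathbf{F}(A\to B)\in S$ as displayed formulas, recurse on each conclusion, NULL if any is NULL, else combined table; (7) otherwise return NULL.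
   Formalization: A set is also counted as inconsistent when it contains F⊤; with the stated definition G({F⊤}) returns NULL although no world realizes F⊤, so part (i) fails; nothing changes for sets in which ⊤ does not occur. *)

theory Defs
  imports Main
begin

datatype 'a fm = Var 'a | Top | Bot | And "'a fm" "'a fm" | Or "'a fm" "'a fm" | Imp "'a fm" "'a fm"

record ('w, 'a) kripke =
  worlds :: "'w set"
  acc :: "'w rel"
  root :: 'w
  atom :: "'w \<Rightarrow> 'a \<Rightarrow> bool"

definition linear_kripke :: "('w, 'a) kripke \<Rightarrow> bool" where
  "linear_kripke K \<longleftrightarrow>
     linear_order_on (worlds K) (acc K) \<and>
     root K \<in> worlds K \<and> (\<forall>\<alpha>\<in>worlds K. (root K, \<alpha>) \<in> acc K) \<and>
     (\<forall>\<alpha>\<in>worlds K. \<forall>\<beta>\<in>worlds K. \<forall>p. (\<alpha>, \<beta>) \<in> acc K \<longrightarrow> atom K \<alpha> p \<longrightarrow> atom K \<beta> p)"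

primrec forces :: "('w, 'a) kripke \<Rightarrow> 'w \<Rightarrow> 'a fm \<Rightarrow> bool" where
  "forces K \<alpha> (Var p) \<longleftrightarrow> atom K \<alpha> p"
| "forces K \<alpha> Top \<longleftrightarrow> True"
| "forces K \<alpha> Bot \<longleftrightarrow> False"
| "forces K \<alpha> (And A B) \<longleftrightarrow> forces K \<alpha> A \<and> forces K \<alpha> B"
| "forces K \<alpha> (Or A B) \<longleftrightarrow> forces K \<alpha> A \<or> forces K \<alpha> B"
| "forces K \<alpha> (Imp A B) \<longleftrightarrow>
     (\<forall>\<beta>\<in>worlds K. (\<alpha>, \<beta>) \<in> acc K \<longrightarrow> forces K \<beta> A \<longrightarrow> forces K \<beta> B)"

text \<open>\<open>Tbar\<close> is the auxiliary label written as an overlined T.\<close>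

datatype 'a sfm = T "'a fm" | F "'a fm" | Tbar "'a fm"

primrec realizes :: "('w, 'a) kripke \<Rightarrow> 'w \<Rightarrow> 'a sfm \<Rightarrow> bool" where
  "realizes K \<alpha> (T A) \<longleftrightarrow> forces K \<alpha> A"
| "realizes K \<alpha> (F A) \<longleftrightarrow> \<not> forces K \<alpha> A"
| "realizes K \<alpha> (Tbar A) \<longleftrightarrow> forces K \<alpha> A"

definition realizes_set :: "('w, 'a) kripke \<Rightarrow> 'w \<Rightarrow> 'a sfm set \<Rightarrow> bool" where
  "realizes_set K \<alpha> S \<longleftrightarrow> (\<forall>H\<in>S. realizes K \<alpha> H)"

text \<open>
  The disjunct \<open>F Top \<in> S\<close> is needed because \<open>Top\<close> is a primitive constant. No rule applies to
  \<open>F Top\<close>, so without this disjunct the procedure below would return NULL on \<open>{F Top}\<close>, which no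
  world of any model realizes. On sets in which \<open>Top\<close> does not occur the disjunct is vacuous.
\<close>

definition inconsistent :: "'a sfm set \<Rightarrow> bool" where
  "inconsistent S \<longleftrightarrow> T Bot \<in> S \<or> F Top \<in> S \<or> (\<exists>A. T A \<in> S \<and> F A \<in> S)"

primrec entails :: "'a sfm set \<Rightarrow> 'a fm \<Rightarrow> bool" where
  "entails S (Var p) \<longleftrightarrow> T (Var p) \<in> S \<or> Tbar (Var p) \<in> S"
| "entails S Top \<longleftrightarrow> T Top \<in> S \<or> Tbar Top \<in> S"
| "entails S Bot \<longleftrightarrow> T Bot \<in> S \<or> Tbar Bot \<in> S"
| "entails S (And B C) \<longleftrightarrow> T (And B C) \<in> S \<or> Tbar (And B C) \<in> S \<or> entails S B \<and> entails S C"
| "entails S (Or B C) \<longleftrightarrow> T (Or B C) \<in> S \<or> Tbar (Or B C) \<in> S \<or> entails S B \<or> entails S C"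
| "entails S (Imp B C) \<longleftrightarrow> T (Imp B C) \<in> S \<or> Tbar (Imp B C) \<in> S \<or>
     F (Imp B C) \<notin> S \<and> (entails S B \<longrightarrow> entails S C)"

datatype rule = TAnd | FAnd | TOr | FOr | TImp1 | TbarImp | FImp

definition T_part :: "'a sfm set \<Rightarrow> 'a sfm set" where
  "T_part S = {H \<in> S. \<exists>A. H = T A \<or> H = Tbar A}"

text \<open>
  \<open>D3 r Hs S Cs\<close>: rule \<open>r\<close>, with displayed formulas \<open>Hs\<close>, is applied to the full premise \<open>S\<close> and has
  conclusions \<open>Cs\<close>. The displayed formulas are not in the side set, so the side set is \<open>S - Hs\<close>.
\<close>

inductive D3 :: "rule \<Rightarrow> 'a sfm set \<Rightarrow> 'a sfm set \<Rightarrow> 'a sfm set list \<Rightarrow> bool" where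
  TAnd: "H = T (And A B) \<Longrightarrow> H \<in> S \<Longrightarrow>
    D3 TAnd {H} S [(S - {H}) \<union> {T A, T B}]"
| FAnd: "H = F (And A B) \<Longrightarrow> H \<in> S \<Longrightarrow>
    D3 FAnd {H} S [(S - {H}) \<union> {F A, F B}, (S - {H}) \<union> {F A, T B}, (S - {H}) \<union> {T A, F B}]"
| TOr: "H = T (Or A B) \<Longrightarrow> H \<in> S \<Longrightarrow>
    D3 TOr {H} S [(S - {H}) \<union> {T A}, (S - {H}) \<union> {T B}]"
| FOr: "H = F (Or A B) \<Longrightarrow> H \<in> S \<Longrightarrow>
    D3 FOr {H} S [(S - {H}) \<union> {F A, F B}]"
| TImp1: "H = T (Imp A B) \<Longrightarrow> H \<in> S \<Longrightarrow>
    D3 TImp1 {H} S [(S - {H}) \<union> {T B}, (S - {H}) \<union> {F A, Tbar (Imp A B)}]"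
| TbarImp: "H = Tbar (Imp A B) \<Longrightarrow> H \<in> S \<Longrightarrow> entails (S - {H}) A \<Longrightarrow>
    D3 TbarImp {H} S [(S - {H}) \<union> {T B}]"
| FImp: "ABs \<noteq> [] \<Longrightarrow> distinct ABs \<Longrightarrow> Hs = (\<lambda>(A, B). F (Imp A B)) ` set ABs \<Longrightarrow> Hs \<subseteq> S \<Longrightarrow>
    D3 FImp Hs S
      (map (\<lambda>(A, B). T_part (S - Hs) \<union> ((Hs - {F (Imp A B)}) \<union> {T A, F B})) ABs)"

text \<open>The proviso of the rule for \<open>Tbar\<close> may equally be checked on the full premise.\<close>

lemma entails_Diff_Tbar_aux:
  "size C < size (Imp A B) \<Longrightarrow> entails (S - {Tbar (Imp A B)}) C \<longleftrightarrow> entails S C"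
  by (induction C) auto

lemma entails_Diff_Tbar: "entails (S - {Tbar (Imp A B)}) A \<longleftrightarrow> entails S A"
  by (rule entails_Diff_Tbar_aux) simp

datatype 'a table = Node "'a sfm set" "'a table list"

primrec table_root :: "'a table \<Rightarrow> 'a sfm set" where
  "table_root (Node S ts) = S"

inductive closed_table :: "'a table \<Rightarrow> bool" where
  leaf: "inconsistent S \<Longrightarrow> closed_table (Node S [])"
| node: "D3 r Hs S (map table_root ts) \<Longrightarrow> (\<And>t. t \<in> set ts \<Longrightarrow> closed_table t) \<Longrightarrow>
    closed_table (Node S ts)"

fun step :: "rule \<Rightarrow> nat" where
  "step TAnd = 2"
| "step FOr = 2"
| "step TOr = 3"
| "step TImp1 = 3"
| "step FAnd = 4"
| "step TbarImp = 5"
| "step FImp = 6"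

definition applicable :: "rule \<Rightarrow> 'a sfm set \<Rightarrow> bool" where
  "applicable r S \<longleftrightarrow> (\<exists>Hs Cs. D3 r Hs S Cs)"

definition F_imps :: "'a sfm set \<Rightarrow> 'a sfm set" where
  "F_imps S = {H \<in> S. \<exists>A B. H = F (Imp A B)}"

text \<open>
  \<open>expand S Cs\<close>: the recursive calls made on a consistent set \<open>S\<close> may be those on \<open>Cs\<close>. The choice of
  the formula treated within one step is left open.
\<close>

definition expand :: "'a sfm set \<Rightarrow> 'a sfm set list \<Rightarrow> bool" where
  "expand S Cs \<longleftrightarrow> (\<exists>r Hs. D3 r Hs S Cs \<and>
     (\<forall>r'. step r' < step r \<longrightarrow> \<not> applicable r' S) \<and>
     (r = FImp \<longrightarrow> Hs = F_imps S))"

text \<open>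
  The procedure leaves choices open, so it is rendered as a relation: \<open>G S x\<close> means that some run on
  \<open>S\<close> returns \<open>x\<close>, where \<open>None\<close> is NULL.
\<close>

inductive G :: "'a sfm set \<Rightarrow> 'a table option \<Rightarrow> bool" where
  closed: "inconsistent S \<Longrightarrow> G S (Some (Node S []))"
| expand_null: "\<not> inconsistent S \<Longrightarrow> expand S Cs \<Longrightarrow> C \<in> set Cs \<Longrightarrow> G C None \<Longrightarrow> G S None"
| expand_proof: "\<not> inconsistent S \<Longrightarrow> expand S Cs \<Longrightarrow> list_all2 (\<lambda>C t. G C (Some t)) Cs ts \<Longrightarrow>
    G S (Some (Node S ts))"
| stuck: "\<not> inconsistent S \<Longrightarrow> (\<And>Cs. \<not> expand S Cs) \<Longrightarrow> G S None"

lemma G_closed_table: "G S (Some t) \<Longrightarrow> closed_table t \<and> table_root t = S"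
proof (induction S "Some t" arbitrary: t rule: G.induct)
  case (expand_proof S Cs ts)
  then obtain r Hs where "D3 r Hs S Cs" by (auto simp: expand_def)
  moreover have "map table_root ts = Cs" "\<forall>t\<in>set ts. closed_table t"
    using expand_proof(3) by (induction rule: list_all2_induct) auto
  ultimately show ?case by (auto intro: closed_table.node)
qed (auto intro: closed_table.leaf)

text \<open>Every run on a finite set terminates, so \<open>G\<close> is total there.\<close>

primrec weight_fm :: "'a fm \<Rightarrow> nat" where
  "weight_fm (Var p) = 1"
| "weight_fm Top = 1"
| "weight_fm Bot = 1"
| "weight_fm (And A B) = weight_fm A + weight_fm B + 2"
| "weight_fm (Or A B) = weight_fm A + weight_fm B + 2"
| "weight_fm (Imp A B) = weight_fm A + weight_fm B + 2"

fun weight :: "'a sfm \<Rightarrow> nat" where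
  "weight (T A) = weight_fm A"
| "weight (F A) = weight_fm A"
| "weight (Tbar (Imp A B)) = weight_fm B + 1"
| "weight (Tbar A) = 0"

lemma weight_fm_pos [simp]: "0 < weight_fm A"
  by (induction A) auto

lemma sum_weight_decreases:
  assumes "finite S" "H \<in> S" "C \<subseteq> (S - {H}) \<union> N" "finite N" "sum weight N < weight H"
  shows "finite C \<and> sum weight C < sum weight S"
proof -
  have fin: "finite ((S - {H}) \<union> N)" using assms by auto
  have "sum weight C \<le> sum weight ((S - {H}) \<union> N)"
    using fin assms(3) by (intro sum_mono2) auto
  also have "\<dots> \<le> sum weight (S - {H}) + sum weight N"
    using sum.union_inter[of "S - {H}" N weight] assms by auto
  also have "\<dots> < sum weight (S - {H}) + weight H" using assms(5) by simp
  also have "\<dots> = sum weight S"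
    using sum.remove[OF assms(1,2), of weight] by simp
  finally show ?thesis using fin assms(3) finite_subset by auto
qed

lemma sum_weight_pair: "sum weight {X, Y} \<le> weight X + weight Y"
  by (cases "X = Y") auto

lemma expand_decreases:
  assumes fin: "finite S" and "expand S Cs" "C \<in> set Cs"
  shows "finite C \<and> sum weight C < sum weight S"
proof -
  note dec = sum_weight_decreases[OF fin]
  have dec2: "finite C \<and> sum weight C < sum weight S"
    if "H \<in> S" "C \<subseteq> (S - {H}) \<union> {X, Y}" "weight X + weight Y < weight H" for H X Y
    using dec[OF that(1,2)] that(3) sum_weight_pair[of X Y] by simp
  have dec1: "finite C \<and> sum weight C < sum weight S"
    if "H \<in> S" "C \<subseteq> (S - {H}) \<union> {X}" "weight X < weight H" for H X
    using dec[OF that(1,2)] that(3) by simp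
  obtain r Hs where D3: "D3 r Hs S Cs" using assms(2) by (auto simp: expand_def)
  from D3 \<open>C \<in> set Cs\<close> show ?thesis
  proof cases
    case (FImp ABs)
    with \<open>C \<in> set Cs\<close> obtain A B where AB: "(A, B) \<in> set ABs"
      "C = T_part (S - Hs) \<union> ((Hs - {F (Imp A B)}) \<union> {T A, F B})" by auto
    show ?thesis
    proof (rule dec2)
      show "F (Imp A B) \<in> S" using FImp AB(1) by force
      show "C \<subseteq> (S - {F (Imp A B)}) \<union> {T A, F B}"
        using FImp AB by (auto simp: T_part_def)
      show "weight (T A) + weight (F B) < weight (F (Imp A B))" by simp
    qed
  next
    case (TAnd H A B)
    then show ?thesis
      using \<open>C \<in> set Cs\<close> dec2[of "T (And A B)" "T A" "T B"] by auto
  next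
    case (FAnd H A B)
    then show ?thesis
      using \<open>C \<in> set Cs\<close> dec2[of "F (And A B)" "F A" "F B"]
        dec2[of "F (And A B)" "F A" "T B"]
        dec2[of "F (And A B)" "T A" "F B"] by auto
  next
    case (TOr H A B)
    then show ?thesis
      using \<open>C \<in> set Cs\<close> dec1[of "T (Or A B)" "T A"]
        dec1[of "T (Or A B)" "T B"] by auto
  next
    case (FOr H A B)
    then show ?thesis
      using \<open>C \<in> set Cs\<close> dec2[of "F (Or A B)" "F A" "F B"] by auto
  next
    case (TImp1 H A B)
    then show ?thesis
      using \<open>C \<in> set Cs\<close> dec1[of "T (Imp A B)" "T B"]
        dec2[of "T (Imp A B)" "F A" "Tbar (Imp A B)"] by auto
  next
    case (TbarImp H A B)
    then show ?thesis
      using \<open>C \<in> set Cs\<close> dec1[of "Tbar (Imp A B)" "T B"] by auto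
  qed
qed

lemma G_total: "finite S \<Longrightarrow> \<exists>x. G S x"
proof (induction "sum weight S" arbitrary: S rule: less_induct)
  case less
  show ?case
  proof (cases "\<not> inconsistent S \<and> (\<exists>Cs. expand S Cs)")
    case True
    then obtain Cs where S: "\<not> inconsistent S" "expand S Cs" by blast
    have ex: "\<exists>x. G C x" if "C \<in> set Cs" for C
      using less expand_decreases[OF less.prems S(2) that] by blast
    show ?thesis
    proof (cases "\<exists>C\<in>set Cs. G C None")
      case True
      with S show ?thesis by (blast intro: G.expand_null)
    next
      case False
      with ex have "\<forall>C\<in>set Cs. \<exists>t. G C (Some t)" by (metis option.exhaust)
      then obtain f where "\<forall>C\<in>set Cs. G C (Some (f C))" by metis
      then have "list_all2 (\<lambda>C t. G C (Some t)) Cs (map f Cs)"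
        by (simp add: list_all2_conv_all_nth)
      with S show ?thesis by (blast intro: G.expand_proof)
    qed
  qed (blast intro: G.closed G.stuck)
qed

end

theory Submission
  imports Defs
begin

text \<open>
  The rule for \<open>Tbar\<close> is not sound for arbitrary sets, since \<open>entails\<close> reads an unlabelled implication
  as true whenever its antecedent is not entailed. In a run of the procedure, however, \<open>Tbar (A \<rightarrow> B)\<close> is always introduced together
  with \<open>F A\<close>, and the rules decompose \<open>F A\<close> far enough that \<open>A\<close> stays determined: its forcing
  value can be read off the current labels. Hence on saturated sets \<open>entails S A\<close> holds iff \<open>A\<close> is
  forced, which gives soundness of that rule. The rule for \<open>F\<close>-implications is sound because in a linear
  order any finitely many refuting worlds have a least one. A countermodel arises by placing a new root, with the
  atoms of \<open>S\<close>, below a model of the open conclusion; \<open>Tbar (A \<rightarrow> B)\<close> holds at the new root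
  because \<open>A\<close>, not entailed, is not forced there.
\<close>

section \<open>Linearly ordered Kripke models\<close>

lemma linear_kripkeD:
  assumes "linear_kripke K"
  shows "(\<alpha>, \<beta>) \<in> acc K \<Longrightarrow> \<alpha> \<in> worlds K \<and> \<beta> \<in> worlds K"
    and "\<alpha> \<in> worlds K \<Longrightarrow> (\<alpha>, \<alpha>) \<in> acc K"
    and "(\<alpha>, \<beta>) \<in> acc K \<Longrightarrow> (\<beta>, \<gamma>) \<in> acc K \<Longrightarrow> (\<alpha>, \<gamma>) \<in> acc K"
    and "(\<alpha>, \<beta>) \<in> acc K \<Longrightarrow> (\<beta>, \<alpha>) \<in> acc K \<Longrightarrow> \<alpha> = \<beta>"
    and "\<alpha> \<in> worlds K \<Longrightarrow> \<beta> \<in> worlds K \<Longrightarrow> (\<alpha>, \<beta>) \<in> acc K \<or> (\<beta>, \<alpha>) \<in> acc K"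
    and "root K \<in> worlds K"
    and "\<alpha> \<in> worlds K \<Longrightarrow> (root K, \<alpha>) \<in> acc K"
    and "(\<alpha>, \<beta>) \<in> acc K \<Longrightarrow> atom K \<alpha> p \<Longrightarrow> atom K \<beta> p"
  using assms
  unfolding linear_kripke_def linear_order_on_def partial_order_on_def preorder_on_def refl_on_def
    total_on_def trans_def antisym_def
  by (blast, blast, blast, blast, metis, blast, blast, blast)

lemma linear_kripkeI:
  assumes "acc K \<subseteq> worlds K \<times> worlds K"
    and "\<And>\<alpha>. \<alpha> \<in> worlds K \<Longrightarrow> (\<alpha>, \<alpha>) \<in> acc K"
    and "\<And>\<alpha> \<beta> \<gamma>. (\<alpha>, \<beta>) \<in> acc K \<Longrightarrow> (\<beta>, \<gamma>) \<in> acc K \<Longrightarrow> (\<alpha>, \<gamma>) \<in> acc K"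
    and "\<And>\<alpha> \<beta>. (\<alpha>, \<beta>) \<in> acc K \<Longrightarrow> (\<beta>, \<alpha>) \<in> acc K \<Longrightarrow> \<alpha> = \<beta>"
    and "\<And>\<alpha> \<beta>. \<alpha> \<in> worlds K \<Longrightarrow> \<beta> \<in> worlds K \<Longrightarrow> (\<alpha>, \<beta>) \<in> acc K \<or> (\<beta>, \<alpha>) \<in> acc K"
    and "root K \<in> worlds K"
    and "\<And>\<alpha>. \<alpha> \<in> worlds K \<Longrightarrow> (root K, \<alpha>) \<in> acc K"
    and "\<And>\<alpha> \<beta> p. (\<alpha>, \<beta>) \<in> acc K \<Longrightarrow> atom K \<alpha> p \<Longrightarrow> atom K \<beta> p"
  shows "linear_kripke K"
proof -
  have "linear_order_on (worlds K) (acc K)"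
    unfolding linear_order_on_def partial_order_on_def preorder_on_def
  proof (intro conjI)
    show "acc K \<subseteq> worlds K \<times> worlds K" by (rule assms(1))
    show "refl_on (worlds K) (acc K)" using assms(2) by (intro refl_onI)
    show "trans (acc K)" using assms(3) by (rule transI)
    show "antisym (acc K)" using assms(4) by (rule antisymI)
    show "total_on (worlds K) (acc K)" using assms(5) by (simp add: total_on_def)
  qed
  then show ?thesis unfolding linear_kripke_def using assms(6-8) by simp
qed

lemma forces_mono:
  assumes "linear_kripke K" "(\<alpha>, \<beta>) \<in> acc K" "forces K \<alpha> A"
  shows "forces K \<beta> A"
  using assms(3)
proof (induction A)
  case (Var p)
  then show ?case using linear_kripkeD(8)[OF assms(1,2)] by simp
next
  case (Imp A B)
  then show ?case using linear_kripkeD(3)[OF assms(1,2)] by auto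
qed auto

text \<open>By induction on \<open>P\<close>, the earlier of two comparable refuting worlds is kept:
  by persistence, an implication refuted later is not forced earlier. Only one antecedent is claimed
  to be forced at \<open>\<beta>\<close>, which is the shape of a conclusion of
  \<open>FImp\<close>.\<close>

lemma common_least_refuter:
  assumes K: "linear_kripke K" and "finite P" "P \<noteq> {}"
    and "\<alpha> \<in> worlds K" and "\<And>A B. (A, B) \<in> P \<Longrightarrow> \<not> forces K \<alpha> (Imp A B)"
  shows "\<exists>A B \<beta>. (A, B) \<in> P \<and> (\<alpha>, \<beta>) \<in> acc K \<and> forces K \<beta> A \<and> \<not> forces K \<beta> B \<and>
    (\<forall>(A', B')\<in>P. \<not> forces K \<beta> (Imp A' B'))"
  using assms(2,3,5)
proof (induction P rule: finite_ne_induct)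
  case (singleton x)
  then obtain A B where x: "x = (A, B)" by (cases x)
  with singleton obtain \<beta> where b: "\<beta> \<in> worlds K" "(\<alpha>, \<beta>) \<in> acc K" "forces K \<beta> A" "\<not> forces K \<beta> B" by auto
  then have "(\<beta>, \<beta>) \<in> acc K" using linear_kripkeD(2)[OF K] by blast
  with b x show ?case by auto
next
  case (insert x P)
  obtain A B where x: "x = (A, B)" by (cases x)
  from insert obtain C D \<beta> where b: "(C, D) \<in> P" "(\<alpha>, \<beta>) \<in> acc K" "forces K \<beta> C" "\<not> forces K \<beta> D"
    "\<forall>(A', B')\<in>P. \<not> forces K \<beta> (Imp A' B')" by blast
  have "\<not> forces K \<alpha> (Imp A B)" using insert.prems x by blast
  then obtain \<gamma> where g: "\<gamma> \<in> worlds K" "(\<alpha>, \<gamma>) \<in> acc K" "forces K \<gamma> A" "\<not> forces K \<gamma> B" by auto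
  have "\<beta> \<in> worlds K" using linear_kripkeD(1)[OF K b(2)] by blast
  then consider "(\<beta>, \<gamma>) \<in> acc K" | "(\<gamma>, \<beta>) \<in> acc K" using linear_kripkeD(5)[OF K] g(1) by blast
  then show ?case
  proof cases
    case 1
    then have "\<not> forces K \<beta> (Imp A B)" using g by auto
    with b x have "(C, D) \<in> insert x P \<and> (\<alpha>, \<beta>) \<in> acc K \<and> forces K \<beta> C \<and> \<not> forces K \<beta> D \<and>
      (\<forall>(A', B')\<in>insert x P. \<not> forces K \<beta> (Imp A' B'))" by (simp del: forces.simps)
    then show ?thesis by blast
  next
    case 2
    then have "\<forall>(A', B')\<in>P. \<not> forces K \<gamma> (Imp A' B')" using b(5) forces_mono[OF K] by blast
    moreover have "\<not> forces K \<gamma> (Imp A B)" using g linear_kripkeD(2)[OF K] by auto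
    ultimately have "(A, B) \<in> insert x P \<and> (\<alpha>, \<gamma>) \<in> acc K \<and> forces K \<gamma> A \<and> \<not> forces K \<gamma> B \<and>
      (\<forall>(A', B')\<in>insert x P. \<not> forces K \<gamma> (Imp A' B'))" using g x by (simp del: forces.simps)
    then show ?thesis by blast
  qed
qed

section \<open>Formulas whose value is fixed by the labels\<close>

primrec pos :: "'a sfm set \<Rightarrow> 'a fm \<Rightarrow> bool" where
  "pos S (Var p) \<longleftrightarrow> T (Var p) \<in> S \<or> Tbar (Var p) \<in> S"
| "pos S Top \<longleftrightarrow> T Top \<in> S \<or> Tbar Top \<in> S"
| "pos S Bot \<longleftrightarrow> T Bot \<in> S \<or> Tbar Bot \<in> S"
| "pos S (And A B) \<longleftrightarrow> T (And A B) \<in> S \<or> Tbar (And A B) \<in> S \<or> pos S A \<and> pos S B"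
| "pos S (Or A B) \<longleftrightarrow> T (Or A B) \<in> S \<or> Tbar (Or A B) \<in> S \<or> pos S A \<or> pos S B"
| "pos S (Imp A B) \<longleftrightarrow> T (Imp A B) \<in> S \<or> Tbar (Imp A B) \<in> S \<or> pos S B"

text \<open>
  \<open>pos S A\<close> is the part of \<open>entails S A\<close> that is valid at every world realizing \<open>S\<close>. A formula is
  determined as soon as it carries a label, and remains so in all later sets of the run.
\<close>

primrec det :: "'a sfm set \<Rightarrow> 'a fm \<Rightarrow> bool" where
  "det S (Var p) \<longleftrightarrow> True"
| "det S Top \<longleftrightarrow> pos S Top \<or> F Top \<in> S"
| "det S Bot \<longleftrightarrow> True"
| "det S (And A B) \<longleftrightarrow> pos S (And A B) \<or> F (And A B) \<in> S \<or> det S A \<and> det S B"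
| "det S (Or A B) \<longleftrightarrow> pos S (Or A B) \<or> F (Or A B) \<in> S \<or> det S A \<and> det S B"
| "det S (Imp A B) \<longleftrightarrow> pos S (Imp A B) \<or> F (Imp A B) \<in> S \<or> pos S A \<and> det S B"

lemma pos_label: "T A \<in> S \<or> Tbar A \<in> S \<Longrightarrow> pos S A"
  by (cases A) auto

lemma det_label: "F A \<in> S \<Longrightarrow> det S A"
  by (cases A) auto

lemma det_if_pos: "pos S A \<Longrightarrow> det S A"
  by (cases A) auto

lemma pos_transfer:
  assumes "\<forall>A. T A \<in> S \<or> Tbar A \<in> S \<longrightarrow> pos C A"
  shows "pos S A \<Longrightarrow> pos C A"
proof (induction A)
  case (And A B) then show ?case using assms[rule_format, of "And A B"] by auto
next
  case (Or A B) then show ?case using assms[rule_format, of "Or A B"] by auto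
next
  case (Imp A B) then show ?case using assms[rule_format, of "Imp A B"] by auto
qed (use assms in fastforce)+

text \<open>This reduces preservation of \<open>det\<close> along a rule to a check of the labelled
  formulas alone; formulas without a label follow structurally.\<close>

lemma det_transfer:
  assumes pos: "\<forall>A. T A \<in> S \<or> Tbar A \<in> S \<longrightarrow> pos C A" and neg: "\<forall>A. F A \<in> S \<longrightarrow> det C A"
  shows "det S A \<Longrightarrow> det C A"
proof (induction A)
  case Top then show ?case using pos[rule_format, of Top] neg[rule_format, of Top] by auto
next
  case (And A B)
  then show ?case
    using pos_transfer[OF pos, where A = "And A B"] det_if_pos[of C "And A B"] neg[rule_format, of "And A B"]
    by auto
next
  case (Or A B)
  then show ?case
    using pos_transfer[OF pos, where A = "Or A B"] det_if_pos[of C "Or A B"] neg[rule_format, of "Or A B"]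
    by auto
next
  case (Imp A B)
  then show ?case
    using pos_transfer[OF pos, where A = "Imp A B"] det_if_pos[of C "Imp A B"] neg[rule_format, of "Imp A B"]
      pos_transfer[OF pos, where A = A]
    by auto
qed auto

section \<open>Invariants of a run\<close>

definition literal_set :: "'a sfm set \<Rightarrow> bool" where
  "literal_set S \<longleftrightarrow>
     (\<forall>A. T A \<in> S \<longrightarrow> A = Top \<or> A = Bot \<or> (\<exists>p. A = Var p)) \<and>
     (\<forall>A. F A \<in> S \<longrightarrow> A = Top \<or> A = Bot \<or> (\<exists>p. A = Var p) \<or> (\<exists>B C. A = Imp B C))"

lemma literal_setI:
  assumes "\<And>r. step r < 5 \<Longrightarrow> \<not> applicable r S"
  shows "literal_set S"
proof -
  have "T (And A B) \<notin> S" for A B using assms[of TAnd] D3.TAnd unfolding applicable_def by fastforce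
  moreover have "T (Or A B) \<notin> S" for A B using assms[of TOr] D3.TOr unfolding applicable_def by fastforce
  moreover have "T (Imp A B) \<notin> S" for A B using assms[of TImp1] D3.TImp1 unfolding applicable_def by fastforce
  moreover have "F (And A B) \<notin> S" for A B using assms[of FAnd] D3.FAnd unfolding applicable_def by fastforce
  moreover have "F (Or A B) \<notin> S" for A B using assms[of FOr] D3.FOr unfolding applicable_def by fastforce
  ultimately show ?thesis unfolding literal_set_def by (metis fm.exhaust)
qed

text \<open>A rule replaces its displayed formula by labels on parts that still fix it. The delicate
  case is \<open>FImp\<close>, which discards \<open>F\<close> formulas: it fires only on literal
  sets and displays every \<open>F\<close>-implication, so what gets lost is \<open>F Bot\<close> or
  \<open>F\<close> of a variable, both determined anyway.\<close>

lemma expand_transfer: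
  assumes "expand S Cs" "\<not> inconsistent S" "C \<in> set Cs"
  shows "(\<forall>A. T A \<in> S \<or> Tbar A \<in> S \<longrightarrow> pos C A) \<and> (\<forall>A. F A \<in> S \<longrightarrow> det C A)"
proof -
  obtain r Hs where D: "D3 r Hs S Cs" and min: "\<And>r'. step r' < step r \<Longrightarrow> \<not> applicable r' S"
    and all: "r = FImp \<Longrightarrow> Hs = F_imps S"
    using assms(1) unfolding expand_def by blast
  \<comment> \<open>Unlike variables and \<open>Bot\<close>, \<open>Top\<close> is not determined
    without a label, and \<open>FImp\<close> would discard \<open>F Top\<close>.\<close>
  have top: "F Top \<notin> S" using assms(2) unfolding inconsistent_def by blast
  have single: "(\<forall>A. T A \<in> S \<or> Tbar A \<in> S \<longrightarrow> pos C A) \<and> (\<forall>A. F A \<in> S \<longrightarrow> det C A)"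
    if "S - {H} \<subseteq> C" and "\<And>A. H = T A \<or> H = Tbar A \<Longrightarrow> pos C A" and "\<And>A. H = F A \<Longrightarrow> det C A" for H
    using that pos_label[of _ C] det_label[of _ C] by blast
  from D assms(3) show ?thesis
  proof cases
    case (FImp ABs)
    have lit: "literal_set S" using min FImp(1) by (intro literal_setI) simp
    have Hs: "Hs = F_imps S" using all FImp(1) by blast
    obtain X Y where XY: "(X, Y) \<in> set ABs"
      and C: "C = T_part (S - Hs) \<union> ((Hs - {F (Imp X Y)}) \<union> {T X, F Y})"
      using FImp(2) assms(3) by auto
    have "pos C A" if "T A \<in> S \<or> Tbar A \<in> S" for A
      using that by (intro pos_label) (auto simp: C Hs T_part_def F_imps_def)
    moreover have "det C A" if A: "F A \<in> S" for A
    proof -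
      \<comment> \<open>The labels \<open>T X\<close> and \<open>F Y\<close> supply the last
        disjunct of \<open>det\<close> for the implication whose own label disappears.\<close>
      have "pos C X" "det C Y" by (auto simp: C intro: pos_label det_label)
      moreover have "F (Imp U V) \<in> C" if "A = Imp U V" "Imp U V \<noteq> Imp X Y" for U V
        using that A by (auto simp: C Hs F_imps_def)
      ultimately have "det C A" if "A = Imp U V" for U V
        using that by (cases "Imp U V = Imp X Y") auto
      moreover have "A = Bot \<or> (\<exists>p. A = Var p) \<or> (\<exists>B C. A = Imp B C)"
        using A lit top unfolding literal_set_def by blast
      ultimately show ?thesis by auto
    qed
    ultimately show ?thesis by blast
  next
    case (TAnd H A B) then show ?thesis using assms(3) by (intro single[of H]) (auto intro: pos_label)
  next
    case (FAnd H A B) then show ?thesis using assms(3)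
      by (intro single[of H]) (auto intro: det_label det_if_pos pos_label)
  next
    case (TOr H A B) then show ?thesis using assms(3) by (intro single[of H]) (auto intro: pos_label)
  next
    case (FOr H A B) then show ?thesis using assms(3) by (intro single[of H]) (auto intro: det_label)
  next
    case (TImp1 H A B) then show ?thesis using assms(3) by (intro single[of H]) (auto intro: pos_label)
  next
    case (TbarImp H A B) then show ?thesis using assms(3) by (intro single[of H]) (auto intro: pos_label)
  qed
qed


definition det_antecedents :: "'a sfm set \<Rightarrow> bool" where
  "det_antecedents S \<longleftrightarrow> (\<forall>A. Tbar A \<in> S \<longrightarrow> (\<exists>B C. A = Imp B C \<and> det S B))"

text \<open>An old \<open>Tbar\<close> formula keeps its determined antecedent by
  \<open>det_transfer\<close>. A new one arises only from \<open>TImp1\<close>, which adds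
  \<open>F A\<close> beside it.\<close>

lemma expand_det_antecedents:
  assumes exp: "expand S Cs" "\<not> inconsistent S" "C \<in> set Cs" and S: "det_antecedents S"
  shows "det_antecedents C"
proof -
  have "\<exists>X Y. A = Imp X Y \<and> det C X" if "Tbar A \<in> C" for A
  proof (cases "Tbar A \<in> S")
    case True
    then show ?thesis
      using S det_transfer[of S C] expand_transfer[OF exp] unfolding det_antecedents_def by blast
  next
    case False
    obtain r Hs where "D3 r Hs S Cs" using exp(1) unfolding expand_def by blast
    then show ?thesis using exp(3) \<open>Tbar A \<in> C\<close> False
      by cases (auto intro: det_label simp: T_part_def)
  qed
  then show ?thesis unfolding det_antecedents_def by blast
qed

section \<open>Soundness at realizing worlds\<close>

lemma realizes_setD:
  assumes "realizes_set K \<alpha> S"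
  shows "T A \<in> S \<Longrightarrow> forces K \<alpha> A" "Tbar A \<in> S \<Longrightarrow> forces K \<alpha> A" "F A \<in> S \<Longrightarrow> \<not> forces K \<alpha> A"
  using assms unfolding realizes_set_def by fastforce+

lemma forces_if_pos:
  assumes K: "linear_kripke K" and S: "realizes_set K \<alpha> S"
  shows "pos S A \<Longrightarrow> forces K \<alpha> A"
proof (induction A)
  case (Imp A B)
  then show ?case using forces_mono[OF K] realizes_setD(1,2)[OF S] by (metis pos.simps(6) forces.simps(6))
qed (use realizes_setD[OF S] in fastforce)+

text \<open>A positive consequent makes an implication entailed unless the implication is labelled
  \<open>F\<close>; the hypothesis excludes this clash.\<close>

lemma entails_if_pos:
  assumes "\<forall>A B. pos S (Imp A B) \<longrightarrow> F (Imp A B) \<notin> S"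
  shows "pos S A \<Longrightarrow> entails S A"
proof (induction A)
  case (Imp A B)
  then show ?case using assms[rule_format, of A B] by auto
qed auto

text \<open>The danger is an implication entailed only because its antecedent is not. If the
  implication is not positive, \<open>det\<close> makes its antecedent positive, hence entailed, so
  the entailment passes to the consequent and persistence finishes. For conjunctions and
  disjunctions, \<open>lit\<close> excludes an \<open>F\<close> label, so \<open>det\<close> passes
  to the parts.\<close>

lemma entails_sound:
  assumes K: "linear_kripke K" and \<alpha>: "\<alpha> \<in> worlds K" and S: "realizes_set K \<alpha> S"
    and lit: "literal_set S"
  shows "det S A \<Longrightarrow> entails S A \<Longrightarrow> forces K \<alpha> A"
proof (induction A)
  case (Imp A B)
  show ?case
  proof (cases "pos S (Imp A B)")
    case True
    then show ?thesis using forces_if_pos[OF K S] by blast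
  next
    case False
    then have F: "F (Imp A B) \<notin> S" using Imp.prems(2) by simp
    then have A: "pos S A" and B: "det S B" using Imp.prems(1) False unfolding det.simps by blast+
    have "entails S A"
    \<comment> \<open>A positive implication labelled \<open>F\<close> would be both forced and not
      forced at \<open>\<alpha>\<close>.\<close>
    proof (rule entails_if_pos[OF _ A])
      show "\<forall>X Y. pos S (Imp X Y) \<longrightarrow> F (Imp X Y) \<notin> S"
        by (intro allI impI notI) (drule forces_if_pos[OF K S], drule realizes_setD(3)[OF S], rule notE)
    qed
    then have "entails S B" using Imp.prems(2) False by auto
    then have "forces K \<alpha> B" using Imp.IH(2) B by blast
    then show ?thesis using forces_mono[OF K] by auto
  qed
next
  case (And A B)
  then show ?case
    using forces_if_pos[OF K S, of "And A B"] lit unfolding literal_set_def by fastforce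
next
  case (Or A B)
  then show ?case
    using forces_if_pos[OF K S, of "Or A B"] lit unfolding literal_set_def by fastforce
qed (use realizes_setD(1,2)[OF S] in \<open>auto, fastforce+\<close>)

text \<open>The world changes only for \<open>FImp\<close>, hence the existential over
  \<open>\<beta>\<close>.\<close>

lemma expand_sound:
  assumes K: "linear_kripke K" and \<alpha>: "\<alpha> \<in> worlds K" and S: "realizes_set K \<alpha> S"
    and exp: "expand S Cs" and det: "det_antecedents S"
  shows "\<exists>C\<in>set Cs. \<exists>\<beta>\<in>worlds K. realizes_set K \<beta> C"
proof -
  obtain r Hs where D: "D3 r Hs S Cs" and min: "\<And>r'. step r' < step r \<Longrightarrow> \<not> applicable r' S"
    using exp unfolding expand_def by blast
  note R = S[unfolded realizes_set_def]
  note RD = realizes_setD[OF S]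
  have stay: ?thesis if "\<exists>C\<in>set Cs. realizes_set K \<alpha> C" using that \<alpha> by blast
  from D show ?thesis
  proof cases
    case (TAnd H A B)
    then have "\<exists>C\<in>set Cs. realizes_set K \<alpha> C" using R RD(1)[of "And A B"] by (auto simp: realizes_set_def)
    then show ?thesis by (rule stay)
  next
    case (FAnd H A B)
    then have "\<exists>C\<in>set Cs. realizes_set K \<alpha> C" using R RD(3)[of "And A B"] by (auto simp: realizes_set_def)
    then show ?thesis by (rule stay)
  next
    case (TOr H A B)
    then have "\<exists>C\<in>set Cs. realizes_set K \<alpha> C" using R RD(1)[of "Or A B"] by (auto simp: realizes_set_def)
    then show ?thesis by (rule stay)
  next
    case (FOr H A B)
    then have "\<exists>C\<in>set Cs. realizes_set K \<alpha> C" using R RD(3)[of "Or A B"] by (auto simp: realizes_set_def)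
    then show ?thesis by (rule stay)
  next
    case (TImp1 H A B)
    have "forces K \<alpha> (Imp A B)" using RD(1) TImp1 by blast
    moreover then have "\<not> forces K \<alpha> A \<or> forces K \<alpha> B" using linear_kripkeD(2)[OF K \<alpha>] \<alpha> by auto
    ultimately have "\<exists>C\<in>set Cs. realizes_set K \<alpha> C" using TImp1 R
      by (auto simp: realizes_set_def simp del: forces.simps)
    then show ?thesis by (rule stay)
  next
    case (TbarImp H A B)
    \<comment> \<open>\<open>TbarImp\<close> belongs to step 5, so the rules of steps 2 to 4 are
      exhausted.\<close>
    have "literal_set S" using min TbarImp(1) by (intro literal_setI) simp
    moreover have "entails S A" using TbarImp entails_Diff_Tbar by blast
    moreover have "det S A" using det TbarImp unfolding det_antecedents_def by blast
    ultimately have "forces K \<alpha> A" using entails_sound[OF K \<alpha> S] by blast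
    moreover have "forces K \<alpha> (Imp A B)" using RD(2) TbarImp by blast
    ultimately have "forces K \<alpha> B" using linear_kripkeD(2)[OF K \<alpha>] \<alpha> by auto
    then show ?thesis using TbarImp R \<alpha> by (auto simp: realizes_set_def)
  next
    case (FImp ABs)
    have "\<not> forces K \<alpha> (Imp A B)" if "(A, B) \<in> set ABs" for A B
      using that FImp RD(3)[of "Imp A B"] by (force simp del: forces.simps)
    \<comment> \<open>The world \<open>\<beta>\<close> selects the conclusion: the pair
      \<open>(A, B)\<close> is split there, while all other displayed implications are still
      refuted.\<close>
    then obtain A B \<beta> where AB: "(A, B) \<in> set ABs" "(\<alpha>, \<beta>) \<in> acc K" "forces K \<beta> A" "\<not> forces K \<beta> B"
      "\<forall>(A', B')\<in>set ABs. \<not> forces K \<beta> (Imp A' B')"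
      using common_least_refuter[OF K _ _ \<alpha>, of "set ABs"] FImp(3) by auto
    have "realizes K \<beta> H" if "H \<in> T_part (S - Hs)" for H
      using that R forces_mono[OF K AB(2)] by (auto simp: T_part_def)
    moreover have "realizes K \<beta> H" if "H \<in> Hs" for H
      using that FImp AB(5) by (auto simp del: forces.simps)
    ultimately have "realizes_set K \<beta> (T_part (S - Hs) \<union> ((Hs - {F (Imp A B)}) \<union> {T A, F B}))"
      using AB by (auto simp: realizes_set_def)
    then show ?thesis using FImp AB(1) linear_kripkeD(1)[OF K AB(2)] by force
  qed
qed

lemma inconsistent_unrealizable:
  assumes "inconsistent S" shows "\<not> realizes_set K \<alpha> S"
proof
  assume "realizes_set K \<alpha> S"
  from realizes_setD[OF this] assms show False unfolding inconsistent_def by fastforce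
qed

text \<open>The induction follows the run instead of the closed table, because
  \<open>expand_sound\<close> relies on the order of the steps. The world is generalized since
  \<open>FImp\<close> may move it.\<close>

lemma G_proof_unrealizable:
  assumes "G S (Some t)" "finite S" "det_antecedents S" and K: "linear_kripke K" and "\<alpha> \<in> worlds K"
  shows "\<not> realizes_set K \<alpha> S"
  using assms(1-3,5)
proof (induction S "Some t" arbitrary: t \<alpha> rule: G.induct)
  case (closed S)
  show ?case by (rule inconsistent_unrealizable[OF closed(1)])
next
  case (expand_proof S Cs ts)
  show ?case
  proof
    assume "realizes_set K \<alpha> S"
    then obtain C \<beta> where C: "C \<in> set Cs" "\<beta> \<in> worlds K" "realizes_set K \<beta> C"
      using expand_sound[OF K] expand_proof by blast
    then obtain t where "finite C \<longrightarrow> det_antecedents C \<longrightarrow> \<not> realizes_set K \<beta> C"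
      using expand_proof(3) by (fastforce simp: list_all2_conv_all_nth in_set_conv_nth)
    then show False
      using C expand_decreases[OF expand_proof(4,2) C(1)]
        expand_det_antecedents[OF expand_proof(2,1) C(1) expand_proof(5)] by blast
  qed
qed

section \<open>Countermodels for saturated sets\<close>

definition saturated :: "'a sfm set \<Rightarrow> bool" where
  "saturated S \<longleftrightarrow> literal_set S \<and> \<not> inconsistent S \<and> det_antecedents S \<and>
     (\<forall>A B. Tbar (Imp A B) \<in> S \<longrightarrow> \<not> entails S A)"

lemma saturatedI:
  assumes "\<And>r. step r < 6 \<Longrightarrow> \<not> applicable r S" "\<not> inconsistent S" "det_antecedents S"
  shows "saturated S"
proof -
  have "\<not> entails S A" if "Tbar (Imp A B) \<in> S" for A B
    using assms(1)[of TbarImp] D3.TbarImp[OF refl that] entails_Diff_Tbar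
    unfolding applicable_def by fastforce
  moreover have "literal_set S" using assms(1) by (intro literal_setI) simp
  ultimately show ?thesis unfolding saturated_def using assms by blast
qed

text \<open>
  The implication case for \<open>Tbar\<close> needs the converse correctness of \<open>entails\<close> on its
  antecedent, and vice versa; both are therefore proved by one induction on the size.
\<close>

lemma saturated_root:
  assumes K: "linear_kripke K" and \<rho>: "\<rho> \<in> worlds K" and sat: "saturated S"
    and atom: "\<And>p. atom K \<rho> p \<longleftrightarrow> T (Var p) \<in> S"
    and neg: "\<And>A B. F (Imp A B) \<in> S \<Longrightarrow> \<not> forces K \<rho> (Imp A B)"
    and later: "\<And>A B \<beta>. Tbar (Imp A B) \<in> S \<Longrightarrow> (\<rho>, \<beta>) \<in> acc K \<Longrightarrow> \<beta> \<noteq> \<rho> \<Longrightarrow>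
      forces K \<beta> A \<Longrightarrow> forces K \<beta> B"
    and coh: "\<And>A B. pos S (Imp A B) \<Longrightarrow> F (Imp A B) \<notin> S"
  shows "realizes_set K \<rho> S"
proof -
  have aux: "(pos S A \<longrightarrow> forces K \<rho> A) \<and> (det S A \<longrightarrow> forces K \<rho> A \<longrightarrow> entails S A)" for A
  proof (induction A rule: measure_induct_rule[of size])
    case (less A)
    have lit: "literal_set S" and con: "\<not> inconsistent S" and da: "det_antecedents S"
      and nent: "\<And>A B. Tbar (Imp A B) \<in> S \<Longrightarrow> \<not> entails S A"
      using sat unfolding saturated_def by auto
    have Tbar: "\<exists>B C. X = Imp B C \<and> det S B" if "Tbar X \<in> S" for X
      using da that unfolding det_antecedents_def by blast
    have comp: "T (And X Y) \<notin> S" "T (Or X Y) \<notin> S" "T (Imp X Y) \<notin> S"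
      "F (And X Y) \<notin> S" "F (Or X Y) \<notin> S" "F Top \<notin> S" "T Bot \<notin> S"
      "Tbar (And X Y) \<notin> S" "Tbar (Or X Y) \<notin> S" "Tbar (Var p) \<notin> S" "Tbar Top \<notin> S" "Tbar Bot \<notin> S"
      for X Y p
      using lit con Tbar unfolding literal_set_def inconsistent_def by fastforce+
    have ent: "pos S X \<Longrightarrow> entails S X" for X using coh by (intro entails_if_pos) auto
    show ?case
    proof (cases A)
      case (And X Y)
      then show ?thesis using less[of X] less[of Y] comp ent by auto
    next
      case (Or X Y)
      then show ?thesis using less[of X] less[of Y] comp ent by auto
    next
      case (Imp X Y)
      have X: "pos S X \<Longrightarrow> forces K \<rho> X" "det S X \<Longrightarrow> forces K \<rho> X \<Longrightarrow> entails S X"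
        and Y: "pos S Y \<Longrightarrow> forces K \<rho> Y" "det S Y \<Longrightarrow> forces K \<rho> Y \<Longrightarrow> entails S Y"
        using less[of X] less[of Y] Imp by auto
      have "forces K \<rho> (Imp X Y)" if "pos S (Imp X Y)"
      proof -
        consider "Tbar (Imp X Y) \<in> S" | "pos S Y" using \<open>pos S (Imp X Y)\<close> comp by auto
        then show ?thesis
        proof cases
          case 1
          \<comment> \<open>The antecedent is determined but not entailed, so the second half of the
            induction hypothesis refutes it at \<open>\<rho>\<close>; the worlds above are covered
            by \<open>later\<close>.\<close>
          then have "\<not> forces K \<rho> X" using Tbar nent X(2) by blast
          then show ?thesis using later[OF 1] by auto
        next
          case 2
          then show ?thesis using Y(1) forces_mono[OF K] by auto
        qed
      qed
      moreover have "entails S (Imp X Y)" if d: "det S (Imp X Y)" and f: "forces K \<rho> (Imp X Y)"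
      proof (cases "pos S (Imp X Y)")
        case True
        then show ?thesis using ent by blast
      next
        case False
        \<comment> \<open>An \<open>F\<close> label is excluded by \<open>neg\<close>, so
          \<open>det\<close> leaves only its last disjunct.\<close>
        then have "pos S X" "det S Y" "F (Imp X Y) \<notin> S" using d f neg by auto
        moreover then have "forces K \<rho> Y" using X(1) f linear_kripkeD(2)[OF K \<rho>] \<rho> by auto
        ultimately show ?thesis using Y(2) by auto
      qed
      ultimately show ?thesis using Imp by blast
    qed (use comp atom in auto)
  qed
  have pos: "forces K \<rho> A" if "T A \<in> S \<or> Tbar A \<in> S" for A
    using aux pos_label[OF that] by blast
  moreover have "\<not> forces K \<rho> A" if "F A \<in> S" for A
  proof -
    \<comment> \<open>Consistency settles variables, through \<open>atom\<close>, and
      \<open>Top\<close>; the remaining cases are \<open>Bot\<close> and implications, the latter by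
      \<open>neg\<close>.\<close>
    have "T A \<notin> S" "A \<noteq> Top" using sat that unfolding saturated_def inconsistent_def by auto
    then show ?thesis
      using sat that neg atom unfolding saturated_def literal_set_def by (metis forces.simps(1,3))
  qed
  ultimately have "realizes K \<rho> H" if "H \<in> S" for H using that by (cases H) auto
  then show ?thesis unfolding realizes_set_def by blast
qed

text \<open>Worlds are natural numbers, so shifting by \<open>Suc\<close> frees 0 for the new root
  and keeps the type fixed.\<close>

definition add_root :: "('a \<Rightarrow> bool) \<Rightarrow> (nat, 'a) kripke \<Rightarrow> (nat, 'a) kripke" where
  "add_root V K = \<lparr>worlds = insert 0 (Suc ` worlds K),
     acc = {0} \<times> insert 0 (Suc ` worlds K) \<union> map_prod Suc Suc ` acc K,
     root = 0, atom = case_nat V (atom K)\<rparr>"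

lemma add_root_simps [simp]:
  "worlds (add_root V K) = insert 0 (Suc ` worlds K)"
  "root (add_root V K) = 0"
  "atom (add_root V K) 0 = V"
  "atom (add_root V K) (Suc n) = atom K n"
  "(0, 0) \<in> acc (add_root V K)"
  "(0, Suc n) \<in> acc (add_root V K) \<longleftrightarrow> n \<in> worlds K"
  "(Suc m, 0) \<notin> acc (add_root V K)"
  "(Suc m, Suc n) \<in> acc (add_root V K) \<longleftrightarrow> (m, n) \<in> acc K"
  by (auto simp: add_root_def)

text \<open>No shifted world sees the new root.\<close>

lemma forces_add_root [simp]: "forces (add_root V K) (Suc n) A \<longleftrightarrow> forces K n A"
  by (induction A arbitrary: n) auto

text \<open>Atoms persist from the new root to any other world by way of the old root.\<close>

lemma linear_add_root:
  assumes K: "linear_kripke K" and V: "\<And>p. V p \<Longrightarrow> atom K (root K) p"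
  shows "linear_kripke (add_root V K)"
proof (rule linear_kripkeI)
  let ?K = "add_root V K"
  show "acc ?K \<subseteq> worlds ?K \<times> worlds ?K"
    using linear_kripkeD(1)[OF K] by (force simp: add_root_def)
  show "(\<alpha>, \<alpha>) \<in> acc ?K" if "\<alpha> \<in> worlds ?K" for \<alpha>
    using that linear_kripkeD(2)[OF K] by auto
  show "(\<alpha>, \<gamma>) \<in> acc ?K" if "(\<alpha>, \<beta>) \<in> acc ?K" "(\<beta>, \<gamma>) \<in> acc ?K" for \<alpha> \<beta> \<gamma>
    using that by (cases \<alpha>; cases \<beta>; cases \<gamma>) (auto dest: linear_kripkeD(1,3)[OF K])
  show "\<alpha> = \<beta>" if "(\<alpha>, \<beta>) \<in> acc ?K" "(\<beta>, \<alpha>) \<in> acc ?K" for \<alpha> \<beta>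
    using that linear_kripkeD(4)[OF K] by (cases \<alpha>; cases \<beta>) auto
  show "(\<alpha>, \<beta>) \<in> acc ?K \<or> (\<beta>, \<alpha>) \<in> acc ?K" if "\<alpha> \<in> worlds ?K" "\<beta> \<in> worlds ?K" for \<alpha> \<beta>
    using that linear_kripkeD(5)[OF K] by (cases \<alpha>; cases \<beta>) auto
  show "atom ?K \<beta> p" if "(\<alpha>, \<beta>) \<in> acc ?K" "atom ?K \<alpha> p" for \<alpha> \<beta> p
    using that by (cases \<alpha>; cases \<beta>) (auto intro: linear_kripkeD(7,8)[OF K] linear_kripkeD(8)[OF K _ V])
qed auto

text \<open>A one-point model suffices: no implication has to be refuted and there is no later
  world.\<close>

lemma realizable_if_no_F_imps:
  assumes sat: "saturated S" and no: "F_imps S = {}"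
  shows "\<exists>K :: (nat, 'a) kripke. linear_kripke K \<and> realizes_set K (root K) (S :: 'a sfm set)"
proof -
  define K :: "(nat, 'a) kripke"
    where "K = \<lparr>worlds = {0}, acc = {(0, 0)}, root = 0, atom = \<lambda>_ p. T (Var p) \<in> S\<rparr>"
  have K: "linear_kripke K" by (rule linear_kripkeI) (auto simp: K_def)
  moreover have "realizes_set K (root K) S"
    by (rule saturated_root[OF K _ sat]) (use no in \<open>auto simp: K_def F_imps_def\<close>)
  ultimately show ?thesis by blast
qed

text \<open>The conclusion keeps all \<open>T\<close> and \<open>Tbar\<close> formulas, so they hold
  from the old root upwards. Every \<open>F\<close>-implication fails at the old root, hence also
  below it.\<close>

lemma realizable_below:
  assumes sat: "saturated S" and XY: "F (Imp X Y) \<in> S"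
    and K: "linear_kripke (K :: (nat, 'a) kripke)"
    and C: "realizes_set K (root K) (T_part (S - F_imps S) \<union> ((F_imps S - {F (Imp X Y)}) \<union> {T X, F Y}))"
      (is "realizes_set K _ ?C")
  shows "\<exists>K :: (nat, 'a) kripke. linear_kripke K \<and> realizes_set K (root K) (S :: 'a sfm set)"
proof -
  have pos: "pos ?C A" if "T A \<in> S \<or> Tbar A \<in> S" for A
    using that by (intro pos_label) (auto simp: T_part_def F_imps_def)
  note forced = forces_if_pos[OF K C]
  let ?K = "add_root (\<lambda>p. T (Var p) \<in> S) K"
  have lin: "linear_kripke ?K"
    using forced[OF pos] by (intro linear_add_root[OF K]) (metis forces.simps(1))
  have XY_root: "forces K (root K) X" "\<not> forces K (root K) Y"
    using realizes_setD[OF C] by auto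
  have neg_root: "\<not> forces K (root K) (Imp A B)" if "F (Imp A B) \<in> S" for A B
  proof (cases "Imp A B = Imp X Y")
    case True
    then show ?thesis using XY_root linear_kripkeD(2,6)[OF K] by auto
  next
    case False
    then show ?thesis using realizes_setD(3)[OF C, of "Imp A B"] that by (auto simp: F_imps_def)
  qed
  have "realizes_set ?K 0 S"
  proof (rule saturated_root[OF lin _ sat])
    show "\<not> forces ?K 0 (Imp A B)" if "F (Imp A B) \<in> S" for A B
      using neg_root[OF that] linear_kripkeD(1)[OF K] by auto
    show "forces ?K \<beta> B"
      if H: "Tbar (Imp A B) \<in> S" "(0, \<beta>) \<in> acc ?K" "\<beta> \<noteq> 0" "forces ?K \<beta> A" for A B \<beta>
    proof -
      obtain n where n: "\<beta> = Suc n" using H(3) not0_implies_Suc by blast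
      have "forces K (root K) (Imp A B)" using forced pos H(1) by blast
      then show ?thesis using H linear_kripkeD(7)[OF K] n by auto
    qed
    \<comment> \<open>A positive implication is forced at the old root, where
      \<open>F\<close>-implications are refuted.\<close>
    show "F (Imp A B) \<notin> S" if "pos S (Imp A B)" for A B
      using neg_root forced pos_transfer[of S ?C, OF _ that] pos by blast
  qed auto
  with lin show ?thesis by auto
qed

section \<open>Models from runs returning NULL\<close>

lemma F_imps_expand:
  assumes "finite S" "F_imps S \<noteq> {}"
  shows "\<exists>Cs. D3 FImp (F_imps S) S Cs"
proof -
  let ?P = "{(A, B). F (Imp A B) \<in> S}"
  have im: "F_imps S = (\<lambda>(A, B). F (Imp A B)) ` ?P" by (auto simp: F_imps_def)
  \<comment> \<open>\<open>FImp\<close> takes a list of pairs; their finiteness comes from that of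
    \<open>S\<close>, as labelling is injective.\<close>
  have "finite ?P"
  proof (rule finite_imageD)
    show "finite ((\<lambda>(A, B). F (Imp A B)) ` ?P)"
      using im assms(1) by (metis (no_types, lifting) F_imps_def finite_subset mem_Collect_eq subsetI)
  qed (auto simp: inj_on_def)
  then obtain ABs where ABs: "set ABs = ?P" "distinct ABs" using finite_distinct_list by blast
  have "D3 FImp (F_imps S) S
      (map (\<lambda>(A, B). T_part (S - F_imps S) \<union> ((F_imps S - {F (Imp A B)}) \<union> {T A, F B})) ABs)"
    by (rule D3.FImp) (use ABs assms im in \<open>auto simp: F_imps_def\<close>)
  then show ?thesis by blast
qed

text \<open>An applicable rule of least step would yield an expansion, whence the induction on
  \<open>step r\<close>.\<close>

lemma not_expand_not_applicable:
  assumes "\<And>Cs. \<not> expand S Cs"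
  shows "step r < 6 \<Longrightarrow> \<not> applicable r S"
proof (induction "step r" arbitrary: r rule: less_induct)
  case less
  show ?case
  proof
    assume "applicable r S"
    then obtain Hs Cs where "D3 r Hs S Cs" unfolding applicable_def by blast
    moreover have "\<not> applicable r' S" if "step r' < step r" for r' using less that by simp
    moreover have "r \<noteq> FImp" using less.prems by auto
    ultimately have "expand S Cs" unfolding expand_def by blast
    then show False using assms by blast
  qed
qed

text \<open>For every rule except \<open>FImp\<close> the same model serves, since each conclusion
  implies the premise at its root; \<open>FImp\<close> requires a new root below.\<close>

lemma expand_invertible:
  assumes exp: "expand S Cs" and con: "\<not> inconsistent S" and det: "det_antecedents S" and C: "C \<in> set Cs"
    and K: "linear_kripke (K :: (nat, 'a) kripke)" and R: "realizes_set K (root K) C"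
  shows "\<exists>K :: (nat, 'a) kripke. linear_kripke K \<and> realizes_set K (root K) (S :: 'a sfm set)"
proof -
  obtain r Hs where D: "D3 r Hs S Cs" and min: "\<And>r'. step r' < step r \<Longrightarrow> \<not> applicable r' S"
    and all: "r = FImp \<Longrightarrow> Hs = F_imps S"
    using exp unfolding expand_def by blast
  have single: ?thesis if "S - {H} \<subseteq> C" "realizes K (root K) H" for H
    using that K R unfolding realizes_set_def by blast
  note RD = realizes_setD[OF R]
  from D show ?thesis
  proof cases
    case (TAnd H A B)
    then show ?thesis using C RD by (intro single[of H]) auto
  next
    case (FAnd H A B)
    then show ?thesis using C RD by (intro single[of H]) auto
  next
    case (TOr H A B)
    then show ?thesis using C RD by (intro single[of H]) auto
  next
    case (FOr H A B)
    then show ?thesis using C RD by (intro single[of H]) auto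
  next
    case (TImp1 H A B)
    have "forces K (root K) (Imp A B)"
    \<comment> \<open>If the formula is absent, \<open>C\<close> is the first conclusion and
      contains \<open>T B\<close>.\<close>
    proof (cases "Tbar (Imp A B) \<in> C")
      case True
      then show ?thesis by (rule RD(2))
    next
      case False
      then have "forces K (root K) B" using TImp1 C RD by auto
      then show ?thesis using forces_mono[OF K] by auto
    qed
    then show ?thesis using TImp1 C by (intro single[of H]) (auto simp del: forces.simps)
  next
    case (TbarImp H A B)
    then have "forces K (root K) B" using C RD by auto
    then have "forces K (root K) (Imp A B)" using forces_mono[OF K] by auto
    then show ?thesis using TbarImp C by (intro single[of H]) (auto simp del: forces.simps)
  next
    case (FImp ABs)
    have "saturated S" using min FImp(1) con det by (intro saturatedI) auto
    moreover have Hs: "Hs = F_imps S" using all FImp(1) by blast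
    moreover obtain X Y where "(X, Y) \<in> set ABs"
      "C = T_part (S - Hs) \<union> ((Hs - {F (Imp X Y)}) \<union> {T X, F Y})"
      using FImp(2) C by auto
    moreover then have "F (Imp X Y) \<in> S" using FImp by force
    ultimately show ?thesis using realizable_below[OF _ _ K] R by blast
  qed
qed

text \<open>A NULL result traces a branch of NULL calls down to a stuck set; its one-point model is
  carried back up that branch.\<close>

lemma G_null_realizable:
  assumes "G S None" "finite S" "det_antecedents S"
  shows "\<exists>K :: (nat, 'a) kripke. linear_kripke K \<and> realizes_set K (root K) (S :: 'a sfm set)"
  using assms
proof (induction S "None :: 'a table option" rule: G.induct)
  case (expand_null S Cs C)
  have "finite C" "det_antecedents C"
    using expand_decreases[OF expand_null(6,2,3)]
      expand_det_antecedents[OF expand_null(2,1,3,7)] by blast+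
  then obtain K :: "(nat, 'a) kripke" where "linear_kripke K" "realizes_set K (root K) C"
    using expand_null(5) by blast
  then show ?case by (rule expand_invertible[OF expand_null(2,1,7,3)])
next
  case (stuck S)
  have app: "\<not> applicable r S" if "step r < 6" for r
    using not_expand_not_applicable[OF stuck(2) that] .
  have "F_imps S = {}"
  proof (rule ccontr)
    assume "F_imps S \<noteq> {}"
    then obtain Cs where "D3 FImp (F_imps S) S Cs" using F_imps_expand[OF stuck(3)] by blast
    \<comment> \<open>With all lower steps inapplicable, \<open>FImp\<close> on all of
      \<open>F_imps S\<close> is a legal move, so a stuck set has no
      \<open>F\<close>-implications.\<close>
    then have "expand S Cs" unfolding expand_def using app by force
    then show False using stuck(2) by blast
  qed
  with saturatedI[OF app stuck(1,4)] show ?case by (rule realizable_if_no_F_imps)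
qed

theorem theorem3:
  fixes S :: "'a sfm set"
  assumes "finite S" and "S \<subseteq> range T \<union> range F"
  shows "(G S None \<longrightarrow>
            (\<exists>K :: (nat, 'a) kripke. linear_kripke K \<and> realizes_set K (root K) S)) \<and>
         ((\<exists>t. G S (Some t)) \<longrightarrow>
            (\<forall>K :: ('w, 'a) kripke. linear_kripke K \<longrightarrow>
               (\<forall>\<alpha>\<in>worlds K. \<not> realizes_set K \<alpha> S)))"
proof -
  \<comment> \<open>The initial set contains no \<open>Tbar\<close>, so the invariant holds
    vacuously.\<close>
  have det: "det_antecedents S" using assms(2) unfolding det_antecedents_def by auto
  show ?thesis
  proof (intro conjI impI allI ballI)
    assume "G S None"
    then show "\<exists>K :: (nat, 'a) kripke. linear_kripke K \<and> realizes_set K (root K) S"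
      using assms(1) det by (rule G_null_realizable)
  next
    fix K :: "('w, 'a) kripke" and \<alpha>
    assume "\<exists>t. G S (Some t)" "linear_kripke K" "\<alpha> \<in> worlds K"
    then show "\<not> realizes_set K \<alpha> S"
      using assms(1) det by (elim exE) (rule G_proof_unrealizable)
  qed
qed

end
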